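(* Let $n\ge 2$ and $m\ge 1$ be coprime integers. Define integers by division with remainder: $m=q_0n+r_0$ with $0<r_0<n$; $n=q_1r_0+r_1$ with $0\le r_1<r_0$; and, if $r_1>0$, $r_0=q_2r_1+r_2$ with $0\le r_2<r_1$. Then: \begin{itemize} \item If $q_0\ge 4$, then $\mathrm{diag}(n,m)=\mathrm{diag}(n,(q_0-4)n+r_0)$. \item If $q_0=3$, then $\mathrm{diag}(n,m)=\mathrm{diag}(n,n-r_0)$. \item If $q_0=2$, then $\mathrm{diag}(n,m)=\mathrm{diag}(n,2n-r_0)$. \item If $q_0=1$ and $q_1\ge 4$, then $\mathrm{diag}(n,m)=\mathrm{diag}((q_1-3)r_0+r_1,(q_1-2)r_0+r_1)$. \item If $q_0=1$, $q_1=3$ and $r_1>0$, then $\mathrm{diag}(n,m)=\mathrm{diag}(r_1,r_0+r_1)$. \item If $q_0=1$, $q_1=2$ and $r_1>0$, then $\mathrm{diag}(n,m)=\mathrm{diag}(r_1,r_0-r_1)$. \item If $q_0=1$, $q_1=1$, $q_2$ is even, and $r_1>r_2>0$, then $\mathrm{diag}(n,m)=\mathrm{diag}(r_1+r_2,r_1+2r_2)$. \item If $q_0=1$, $q_1=1$, $q_2$ is even, and $r_1>r_2=0$, then $\mathrm{diag}(n,m)=\mathrm{diag}(1,1)$. \item If $q_0=1$, $q_1=1$, $q_2$ is odd, and $r_1>r_2>0$, then $\mathrm{diag}(n,m)=\mathrm{diag}(r_2,r_1+2r_2)$. \item If $q_0=1$, $q_1=1$, $q_2$ is odd, and $r_1>r_2=0$,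 then $\mathrm{diag}(n,m)=\mathrm{diag}(2,3)$. \end{itemize}
   Context: For positive integers $n,m$, the graph $G_{n,m,2}$ (an augmented directed grid graph on a two-holed torus) is defined as follows. Its vertices are the $4nm$ cells $(i,c)$ of a grid with $2n$ rows $0\le i<2n$ (row $0$ on top) and $2m$ columns $0\le c<2m$ (column $0$ leftmost). The bijection $u$ ("up") on cells is $u(i,c)=(i-1,c)$ if $i\ge 1$, and $u(0,c)=(2n-1,(c+m)\bmod 2m)$. The bijection $r$ ("right") on cells is $r(i,c)=(i,c+1)$ if $c<2m-1$, and $r(i,2m-1)=((i+n)\bmod 2n,0)$. The directed edges are $(\alpha,u\alpha)$ and $(\alpha,r\alpha)$ for every cell $\alpha$. A diagonal is a set $\{\alpha,u^{-1}r\alpha,(u^{-1}r)^2\alpha,\dots\}$ for a cell $\alpha$, i.e. an orbit of the permutation $u^{-1}r$ (apply $r$ first, then $u^{-1}$) on cells. $\mathrm{diag}(n,m)$ denotes the number of diagonals of $G_{n,m,2}$. *)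

theory Defs
  imports Main
begin

type_synonym cell = "nat \<times> nat"

definition cells :: "nat \<Rightarrow> nat \<Rightarrow> cell set" where
  "cells n m = {0..<2 * n} \<times> {0..<2 * m}"

text \<open>
  Both maps are meant to be applied to cells only. The truncated subtractions are exact there.
\<close>

definition up :: "nat \<Rightarrow> nat \<Rightarrow> cell \<Rightarrow> cell" where
  "up n m = (\<lambda>(i, c). if i \<ge> 1 then (i - 1, c) else (2 * n - 1, (c + m) mod (2 * m)))"

definition right :: "nat \<Rightarrow> nat \<Rightarrow> cell \<Rightarrow> cell" where
  "right n m = (\<lambda>(i, c). if c < 2 * m - 1 then (i, c + 1) else ((i + n) mod (2 * n), 0))"

definition diag_step :: "nat \<Rightarrow> nat \<Rightarrow> cell \<Rightarrow> cell" where
  "diag_step n m = inv_into (cells n m) (up n m) \<circ> right n m"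

definition diagonal :: "nat \<Rightarrow> nat \<Rightarrow> cell \<Rightarrow> cell set" where
  "diagonal n m a = {(diag_step n m ^^ k) a | k. True}"

definition diag :: "nat \<Rightarrow> nat \<Rightarrow> nat" where
  "diag n m = card (diagonal n m ` cells n m)"

text \<open>
  The two maps permute the cells, so that the inverse in \<^const>\<open>diag_step\<close> is a genuine one.
\<close>

lemma add_half_mod_twice:
  fixes x k :: nat
  assumes "x < 2 * k"
  shows "(x + k) mod (2 * k) = (if x < k then x + k else x - k)"
  using assms by (auto simp: mod_if)

lemma finite_cells: "finite (cells n m)"
  by (simp add: cells_def)

lemma bij_betw_up: "bij_betw (up n m) (cells n m) (cells n m)"
proof -
  have "inj_on (up n m) (cells n m)"
    by (auto simp: inj_on_def up_def cells_def add_half_mod_twice split: if_splits)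
  moreover have "up n m ` cells n m \<subseteq> cells n m"
    by (auto simp: up_def cells_def split: if_splits)
  ultimately show ?thesis
    using endo_inj_surj[OF finite_cells] by (metis bij_betw_def)
qed

lemma bij_betw_right: "bij_betw (right n m) (cells n m) (cells n m)"
proof -
  have "inj_on (right n m) (cells n m)"
    by (auto simp: inj_on_def right_def cells_def add_half_mod_twice split: if_splits)
  moreover have "right n m ` cells n m \<subseteq> cells n m"
    by (auto simp: right_def cells_def split: if_splits)
  ultimately show ?thesis
    using endo_inj_surj[OF finite_cells] by (metis bij_betw_def)
qed

lemma bij_betw_diag_step: "bij_betw (diag_step n m) (cells n m) (cells n m)"
  unfolding diag_step_def
  using bij_betw_right bij_betw_inv_into[OF bij_betw_up] by (rule bij_betw_trans)

end

theory Submission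
  imports Defs
begin

text \<open>
  The grid consists of four blocks of size \<open>n \<times> m\<close>, and crossing a block boundary permutes the
  blocks by \<open>R\<close> (right) or \<open>D\<close> (down). Recording only the boundary crossings, the diagonals
  become the orbits of a two-interval exchange on \<open>n + m\<close> points, extended by the two block
  permutations. Rauzy induction (first return to a shorter interval) replaces \<open>(n, m + n)\<close> with
  labels \<open>a, b\<close> by \<open>(n, m)\<close> with labels \<open>b \<circ> a, b\<close>, and \<open>(n + m, m)\<close> by \<open>(n, m)\<close> with labels
  \<open>a, b \<circ> a\<close>, so both sides of each claimed equation can be run down to a common pair of lengths.
  It then remains to compare the labels up to simultaneous conjugation, which uses
  \<open>D\<^sup>4 = (D R)\<^sup>3 = (D\<^sup>2 R)\<^sup>2 = 1\<close> and a few explicit conjugations.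
\<close>

section \<open>Counting orbits\<close>

text \<open>Forward orbits that meet. This is an equivalence relation for every map, so nothing has
  to be shown bijective; for a permutation it means lying on the same cycle.\<close>

definition linked :: "('a \<Rightarrow> 'a) \<Rightarrow> 'a \<Rightarrow> 'a \<Rightarrow> bool" where
  "linked f x y \<longleftrightarrow> (\<exists>k l. (f ^^ k) x = (f ^^ l) y)"

definition orbit_class :: "('a \<Rightarrow> 'a) \<Rightarrow> 'a set \<Rightarrow> 'a \<Rightarrow> 'a set" where
  "orbit_class f A x = {y \<in> A. linked f x y}"

definition norbits :: "('a \<Rightarrow> 'a) \<Rightarrow> 'a set \<Rightarrow> nat" where
  "norbits f A = card (orbit_class f A ` A)"

lemma linkedI: "(f ^^ k) x = (f ^^ l) y \<Longrightarrow> linked f x y"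
  unfolding linked_def by (intro exI)

lemma linkedE:
  assumes "linked f x y"
  obtains k l where "(f ^^ k) x = (f ^^ l) y"
  using assms unfolding linked_def by (elim exE)

lemma linked_refl [simp]: "linked f x x"
  by (rule linkedI) (rule refl)

lemma linked_sym: "linked f x y \<Longrightarrow> linked f y x"
  by (erule linkedE) (rule linkedI, erule sym)

lemma linked_trans:
  assumes "linked f x y" "linked f y z"
  shows "linked f x z"
proof -
  obtain k l where kl: "(f ^^ k) x = (f ^^ l) y"
    using assms(1) by (rule linkedE)
  obtain p q where pq: "(f ^^ p) y = (f ^^ q) z"
    using assms(2) by (rule linkedE)
  \<comment> \<open>Raise both meetings to a common one: apply \<open>f ^^ p\<close> to the first
    and \<open>f ^^ l\<close> to the second; powers of \<open>f\<close> commute.\<close>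
  have "(f ^^ (p + k)) x = (f ^^ (p + l)) y"
    using kl by (simp add: funpow_add)
  also have "\<dots> = (f ^^ (l + q)) z"
    using pq by (simp add: funpow_add add.commute[of p])
  finally show ?thesis
    by (rule linkedI)
qed

lemma linked_funpow: "linked f x ((f ^^ k) x)"
  by (rule linkedI[where k = k and l = 0]) simp

lemma linked_step: "linked f x (f x)"
  using linked_funpow[of f x 1] by simp

lemma orbit_class_eq_iff:
  assumes "x \<in> A" "y \<in> A"
  shows "orbit_class f A x = orbit_class f A y \<longleftrightarrow> linked f x y"
proof
  assume "orbit_class f A x = orbit_class f A y"
  moreover have "y \<in> orbit_class f A y"
    using assms by (simp add: orbit_class_def)
  ultimately have "y \<in> orbit_class f A x"
    by simp
  then show "linked f x y"
    by (simp add: orbit_class_def)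
next
  assume xy: "linked f x y"
  have "linked f x z \<longleftrightarrow> linked f y z" for z
    using linked_trans[OF xy] linked_trans[OF linked_sym[OF xy]] by (rule iffI[rotated])
  then show "orbit_class f A x = orbit_class f A y"
    by (simp add: orbit_class_def)
qed

text \<open>\<open>F\<close> and \<open>G\<close> induce the same partition of \<open>A\<close>, so
  \<open>F x \<mapsto> G x\<close> is a well-defined bijection between the images.\<close>

lemma card_image_same_kernel:
  assumes "\<And>x y. x \<in> A \<Longrightarrow> y \<in> A \<Longrightarrow> F x = F y \<longleftrightarrow> G x = G y"
  shows "card (F ` A) = card (G ` A)"
proof -
  define h where "h = (\<lambda>C. G (inv_into A F C))"
  have h: "h (F x) = G x" if "x \<in> A" for x
  proof -
    have "F x \<in> F ` A" using that by (rule imageI)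
    then have "inv_into A F (F x) \<in> A" "F (inv_into A F (F x)) = F x"
      by (rule inv_into_into, rule f_inv_into_f)
    then show ?thesis
      unfolding h_def using assms that by blast
  qed
  have "bij_betw h (F ` A) (G ` A)"
  proof (rule bij_betw_imageI)
    show "inj_on h (F ` A)"
    proof (rule inj_onI)
      fix C C' assume "C \<in> F ` A" "C' \<in> F ` A" "h C = h C'"
      then obtain x y where "x \<in> A" "y \<in> A" "C = F x" "C' = F y" "G x = G y"
        using h by auto
      then show "C = C'"
        using assms by blast
    qed
    show "h ` F ` A = G ` A"
      unfolding image_image using h by (rule image_cong[OF refl])
  qed
  then show ?thesis
    by (rule bij_betw_same_card)
qed

lemma linked_map:
  assumes "f ` A \<subseteq> A" and step: "\<And>x. x \<in> A \<Longrightarrow> linked g (\<phi> x) (\<phi> (f x))"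
    and "x \<in> A" "y \<in> A" "linked f x y"
  shows "linked g (\<phi> x) (\<phi> y)"
proof -
  have along: "(f ^^ k) z \<in> A \<and> linked g (\<phi> z) (\<phi> ((f ^^ k) z))" if "z \<in> A" for z k
  proof (induction k)
    case 0
    then show ?case using that by simp
  next
    case (Suc k)
    then have z: "(f ^^ k) z \<in> A" "linked g (\<phi> z) (\<phi> ((f ^^ k) z))"
      by auto
    have "linked g (\<phi> z) (\<phi> (f ((f ^^ k) z)))"
      using linked_trans[OF z(2) step[OF z(1)]] .
    moreover have "f ((f ^^ k) z) \<in> A"
      using z(1) assms(1) by auto
    ultimately show ?case
      by simp
  qed
  obtain k l where "(f ^^ k) x = (f ^^ l) y"
    using assms(5) by (rule linkedE)
  then have "linked g (\<phi> x) (\<phi> ((f ^^ l) y))"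
    using along[OF assms(3), of k] by simp
  moreover have "linked g (\<phi> ((f ^^ l) y)) (\<phi> y)"
    using linked_sym[OF conjunct2[OF along[OF assms(4), of l]]] .
  ultimately show ?thesis
    by (rule linked_trans)
qed

text \<open>\<open>\<phi>\<close> and \<open>\<psi>\<close> need only be inverse to each other up to
  linkedness; they then induce inverse bijections of classes. This freedom allows passing to a
  first-return map on a smaller set.\<close>

lemma norbits_eqI:
  assumes "f ` A \<subseteq> A" "g ` B \<subseteq> B" "\<phi> ` A \<subseteq> B" "\<psi> ` B \<subseteq> A"
    and \<phi>: "\<And>x. x \<in> A \<Longrightarrow> linked g (\<phi> x) (\<phi> (f x))"
    and \<psi>: "\<And>y. y \<in> B \<Longrightarrow> linked f (\<psi> y) (\<psi> (g y))"
    and \<psi>\<phi>: "\<And>x. x \<in> A \<Longrightarrow> linked f (\<psi> (\<phi> x)) x"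
    and \<phi>\<psi>: "\<And>y. y \<in> B \<Longrightarrow> linked g (\<phi> (\<psi> y)) y"
  shows "norbits f A = norbits g B"
proof -
  have iff: "linked f x y \<longleftrightarrow> linked g (\<phi> x) (\<phi> y)" if "x \<in> A" "y \<in> A" for x y
  proof
    assume xy: "linked f x y"
    show "linked g (\<phi> x) (\<phi> y)"
      by (rule linked_map[where f = f and A = A and \<phi> = \<phi>, OF assms(1) \<phi> that xy])
  next
    have B: "\<phi> x \<in> B" "\<phi> y \<in> B"
      using assms(3) that by auto
    assume xy: "linked g (\<phi> x) (\<phi> y)"
    have "linked f (\<psi> (\<phi> x)) (\<psi> (\<phi> y))"
      by (rule linked_map[where f = g and A = B and \<phi> = \<psi>, OF assms(2) \<psi> B xy])
    then show "linked f x y"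
      by (rule linked_trans[OF linked_sym[OF \<psi>\<phi>[OF that(1)]] linked_trans[OF _ \<psi>\<phi>[OF that(2)]]])
  qed
  have "norbits f A = card ((\<lambda>x. orbit_class g B (\<phi> x)) ` A)"
    unfolding norbits_def
  proof (rule card_image_same_kernel)
    fix x y assume "x \<in> A" "y \<in> A"
    moreover from this have "\<phi> x \<in> B" "\<phi> y \<in> B"
      using assms(3) by auto
    ultimately show "orbit_class f A x = orbit_class f A y
        \<longleftrightarrow> orbit_class g B (\<phi> x) = orbit_class g B (\<phi> y)"
      by (simp add: orbit_class_eq_iff iff)
  qed
  also have "(\<lambda>x. orbit_class g B (\<phi> x)) ` A = orbit_class g B ` B"
  proof
    show "orbit_class g B ` B \<subseteq> (\<lambda>x. orbit_class g B (\<phi> x)) ` A"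
    proof
      fix C assume "C \<in> orbit_class g B ` B"
      then obtain y where y: "y \<in> B" "C = orbit_class g B y" by blast
      then have "\<psi> y \<in> A" "\<phi> (\<psi> y) \<in> B"
        using assms(3,4) by blast+
      moreover from this have "orbit_class g B (\<phi> (\<psi> y)) = C"
        using y \<phi>\<psi> by (simp add: orbit_class_eq_iff)
      ultimately show "C \<in> (\<lambda>x. orbit_class g B (\<phi> x)) ` A" by blast
    qed
  qed (use assms(3) in blast)
  finally show ?thesis
    by (simp add: norbits_def)
qed

text \<open>On a finite set an injection that maps a forward orbit into itself maps it onto itself.
  Hence forward orbits do not shrink along \<open>f\<close> and coincide with the classes of
  \<open>linked\<close>.\<close>

lemma card_forward_orbits:
  assumes "finite A" "bij_betw f A A"
  shows "card ((\<lambda>x. {(f ^^ k) x | k. True}) ` A) = norbits f A"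
proof -
  let ?O = "\<lambda>x. {(f ^^ k) x | k. True}"
  have self: "x \<in> ?O x" for x
    by (auto intro: exI[of _ 0])
  have in_A: "(f ^^ k) x \<in> A" if "x \<in> A" for x k
    using that assms(2) by (induction k) (auto simp: bij_betw_def)
  have step: "?O (f x) = ?O x" if "x \<in> A" for x
  proof -
    have sub: "?O x \<subseteq> A"
      using in_A that by blast
    have f_O: "f ` ?O x = ?O (f x)"
    proof -
      have "f ` ?O x = {f ((f ^^ k) x) | k. True}"
        by blast
      then show ?thesis
        by (simp only: funpow_swap1)
    qed
    have "?O (f x) \<subseteq> ?O x"
    proof
      fix z assume "z \<in> ?O (f x)"
      then obtain k where "z = (f ^^ Suc k) x"
        by (auto simp: funpow_swap1)
      then show "z \<in> ?O x" by blast
    qed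
    moreover have "inj_on f (?O x)"
      using assms(2) sub by (auto simp: bij_betw_def intro: inj_on_subset)
    ultimately have "f ` ?O x = ?O x"
      by (intro endo_inj_surj[OF finite_subset[OF sub assms(1)]]) (simp_all only: f_O)
    then show ?thesis
      using f_O by simp
  qed
  have steps: "?O ((f ^^ k) x) = ?O x" if "x \<in> A" for x k
  proof (induction k)
    case (Suc k)
    then show ?case using step[OF in_A[OF that, of k]] by simp
  qed simp
  have iff: "?O x = ?O y \<longleftrightarrow> linked f x y" if "x \<in> A" "y \<in> A" for x y
  proof
    assume "?O x = ?O y"
    then have "y \<in> ?O x"
      using self[of y] by simp
    then obtain k where "y = (f ^^ k) x"
      by blast
    then show "linked f x y"
      by (simp add: linked_funpow)
  next
    assume "linked f x y"
    then obtain k l where "(f ^^ k) x = (f ^^ l) y"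
      by (rule linkedE)
    then show "?O x = ?O y"
      using steps[OF that(1), of k] steps[OF that(2), of l] by simp
  qed
  show ?thesis
    unfolding norbits_def
    by (rule card_image_same_kernel) (simp only: iff orbit_class_eq_iff)
qed

section \<open>Labelled two-interval exchanges\<close>

text \<open>On the second coordinate this is the rotation by \<open>m\<close> of
  \<open>n + m\<close> points; the labels \<open>a\<close> and \<open>b\<close> make it a skew
  product with the set of blocks as fibre.\<close>

definition exch :: "('a \<Rightarrow> 'a) \<Rightarrow> ('a \<Rightarrow> 'a) \<Rightarrow> nat \<Rightarrow> nat \<Rightarrow> 'a \<times> nat \<Rightarrow> 'a \<times> nat" where
  "exch a b n m = (\<lambda>(s, x). if x < n then (a s, x + m) else (b s, x - n))"

definition ncyc :: "('a \<Rightarrow> 'a) \<Rightarrow> ('a \<Rightarrow> 'a) \<Rightarrow> nat \<Rightarrow> nat \<Rightarrow> nat" where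
  "ncyc a b n m = norbits (exch a b n m) (UNIV \<times> {..<n + m})"

lemma exch_apply:
  "x < n \<Longrightarrow> exch a b n m (s, x) = (a s, x + m)"
  "n \<le> x \<Longrightarrow> exch a b n m (s, x) = (b s, x - n)"
  by (simp_all add: exch_def)

lemma exch_closed: "exch a b n m ` (UNIV \<times> {..<n + m}) \<subseteq> UNIV \<times> {..<n + m}"
  by (auto simp: exch_def split: if_splits)

lemma linkedI_step:
  "f x = y \<Longrightarrow> linked f x y"
  "f (f x) = y \<Longrightarrow> linked f x y"
  "f y = x \<Longrightarrow> linked f x y"
  using linked_step[of f x] linked_step[of f "f x"] linked_step[of f y] linked_trans linked_sym
  by fast+

lemma ncyc_eqI:
  assumes "\<And>s x. x < n + m \<Longrightarrow> snd (\<phi> (s, x)) < n' + m'"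
    and "\<And>s x. x < n' + m' \<Longrightarrow> snd (\<psi> (s, x)) < n + m"
    and "\<And>s x. x < n + m \<Longrightarrow> linked (exch a' b' n' m') (\<phi> (s, x)) (\<phi> (exch a b n m (s, x)))"
    and "\<And>s x. x < n' + m' \<Longrightarrow> linked (exch a b n m) (\<psi> (s, x)) (\<psi> (exch a' b' n' m' (s, x)))"
    and "\<And>s x. x < n + m \<Longrightarrow> linked (exch a b n m) (\<psi> (\<phi> (s, x))) (s, x)"
    and "\<And>s x. x < n' + m' \<Longrightarrow> linked (exch a' b' n' m') (\<phi> (\<psi> (s, x))) (s, x)"
  shows "ncyc a b n m = ncyc a' b' n' m'"
  unfolding ncyc_def
proof (rule norbits_eqI[where \<phi> = \<phi> and \<psi> = \<psi>])
  show "\<phi> ` (UNIV \<times> {..<n + m}) \<subseteq> UNIV \<times> {..<n' + m'}"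
    using assms(1) by (auto simp: image_subset_iff mem_Times_iff)
  show "\<psi> ` (UNIV \<times> {..<n' + m'}) \<subseteq> UNIV \<times> {..<n + m}"
    using assms(2) by (auto simp: image_subset_iff mem_Times_iff)
  show "exch a b n m ` (UNIV \<times> {..<n + m}) \<subseteq> UNIV \<times> {..<n + m}"
    "exch a' b' n' m' ` (UNIV \<times> {..<n' + m'}) \<subseteq> UNIV \<times> {..<n' + m'}"
    by (rule exch_closed)+
qed (use assms(3-6) in \<open>auto simp only: mem_Times_iff lessThan_iff split_paired_all snd_conv\<close>)

section \<open>Rauzy induction, reversal and relabelling\<close>

text \<open>First return to \<open>x < n + m\<close>. A point \<open>x < n\<close> leaves this range
  with label \<open>a\<close> and is brought back at once with label \<open>b\<close>, landing at
  \<open>x + m\<close>; a point with \<open>n \<le> x < n + m\<close> returns in one step. Points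
  outside are pushed in by one step.\<close>

lemma ncyc_add_right: "ncyc a b n (m + n) = ncyc (b \<circ> a) b n m"
proof (rule ncyc_eqI[where \<psi> = "\<lambda>y. y"
      and \<phi> = "\<lambda>(s, x). if x < n + m then (s, x) else (b s, x - n)"])
  fix s :: 'a and x assume "x < n + (m + n)"
  then show "linked (exch (b \<circ> a) b n m) (case (s, x) of (s, x) \<Rightarrow> if x < n + m then (s, x) else (b s, x - n))
      (case exch a b n (m + n) (s, x) of (s, x) \<Rightarrow> if x < n + m then (s, x) else (b s, x - n))"
    by (cases "x < n"; cases "x < n + m") (simp_all add: exch_apply linkedI_step(1))
next
  fix s :: 'a and x assume "x < n + m"
  then show "linked (exch a b n (m + n)) (s, x) (exch (b \<circ> a) b n m (s, x))"
    by (cases "x < n") (simp_all add: exch_apply linkedI_step(1,2))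
qed (auto simp: exch_apply linkedI_step(3))

text \<open>Again first return to \<open>x < n + m\<close>. Now \<open>x < n\<close> stays inside
  after one step, while \<open>n \<le> x < n + m\<close> goes out with \<open>a\<close> and comes
  back with \<open>b\<close> at \<open>x - n\<close>.\<close>

lemma ncyc_add_left: "ncyc a b (n + m) m = ncyc a (b \<circ> a) n m"
proof (rule ncyc_eqI[where \<psi> = "\<lambda>y. y"
      and \<phi> = "\<lambda>(s, x). if x < n + m then (s, x) else (b s, x - (n + m))"])
  fix s :: 'a and x assume "x < n + m + m"
  then show "linked (exch a (b \<circ> a) n m)
      (case (s, x) of (s, x) \<Rightarrow> if x < n + m then (s, x) else (b s, x - (n + m)))
      (case exch a b (n + m) m (s, x) of (s, x) \<Rightarrow> if x < n + m then (s, x) else (b s, x - (n + m)))"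
    by (cases "x < n"; cases "x < n + m") (simp_all add: exch_apply linkedI_step(1))
next
  fix s :: 'a and x assume "x < n + m"
  then show "linked (exch a b (n + m) m) (s, x) (exch a (b \<circ> a) n m (s, x))"
    by (cases "x < n") (simp_all add: exch_apply linkedI_step(1,2))
qed (auto simp: exch_apply linkedI_step(3))

lemma ncyc_add_mult_right: "ncyc a b n (m + k * n) = ncyc ((b ^^ k) \<circ> a) b n m"
proof (induction k arbitrary: a)
  case (Suc k)
  have "ncyc a b n (m + Suc k * n) = ncyc a b n ((m + k * n) + n)"
    by (simp add: algebra_simps)
  then show ?case
    using Suc by (simp add: ncyc_add_right funpow_Suc_right comp_assoc del: funpow.simps)
qed simp

lemma ncyc_add_mult_left: "ncyc a b (n + k * m) m = ncyc a (b \<circ> (a ^^ k)) n m"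
proof (induction k arbitrary: b)
  case (Suc k)
  have "ncyc a b (n + Suc k * m) m = ncyc a b ((n + k * m) + m) m"
    by (simp add: algebra_simps)
  then show ?case
    using Suc by (simp add: ncyc_add_left comp_assoc)
qed simp

text \<open>Reversing the order of the points exchanges the two intervals together with their
  labels.\<close>

lemma ncyc_swap: "ncyc a b n m = ncyc b a m n"
proof (rule ncyc_eqI[where \<phi> = "\<lambda>(s, x). (s, n + m - 1 - x)" and \<psi> = "\<lambda>(s, x). (s, n + m - 1 - x)"])
  fix s :: 'a and x assume "x < n + m"
  then show "linked (exch b a m n) (case (s, x) of (s, x) \<Rightarrow> (s, n + m - 1 - x))
      (case exch a b n m (s, x) of (s, x) \<Rightarrow> (s, n + m - 1 - x))"
    by (cases "x < n") (simp_all add: exch_apply linkedI_step(1))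
next
  fix s :: 'a and x assume "x < m + n"
  then show "linked (exch a b n m) (case (s, x) of (s, x) \<Rightarrow> (s, n + m - 1 - x))
      (case exch b a m n (s, x) of (s, x) \<Rightarrow> (s, n + m - 1 - x))"
    by (cases "x < m") (simp_all add: exch_apply linkedI_step(1))
qed auto

lemma ncyc_conj:
  assumes "h \<circ> a = a' \<circ> h" "h \<circ> b = b' \<circ> h" "h' \<circ> h = id" "h \<circ> h' = id"
  shows "ncyc a b n m = ncyc a' b' n m"
proof -
  have h: "h (a s) = a' (h s)" "h (b s) = b' (h s)" "h' (h s) = s" for s
    using assms by (simp_all add: fun_eq_iff)
  have h_h': "h (h' s) = s" for s
    using assms by (simp add: fun_eq_iff)
  have h': "h' (a' s) = a (h' s)" "h' (b' s) = b (h' s)" for s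
    using h[of "h' s"] h(3)[of "a (h' s)"] h(3)[of "b (h' s)"] h_h'[of s] by simp_all
  show ?thesis
  proof (rule ncyc_eqI[where \<phi> = "\<lambda>(s, x). (h s, x)" and \<psi> = "\<lambda>(s, x). (h' s, x)"])
    fix s x assume "x < n + m"
    show "linked (exch a' b' n m) (case (s, x) of (s, x) \<Rightarrow> (h s, x))
        (case exch a b n m (s, x) of (s, x) \<Rightarrow> (h s, x))"
      by (cases "x < n") (simp_all add: exch_apply linkedI_step(1) h)
    show "linked (exch a b n m) (case (s, x) of (s, x) \<Rightarrow> (h' s, x))
        (case exch a' b' n m (s, x) of (s, x) \<Rightarrow> (h' s, x))" for s
      by (cases "x < n") (simp_all add: exch_apply linkedI_step(1) h')
  qed (auto simp: h h_h')
qed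

text \<open>The left interval is empty, so its label is never applied.\<close>

lemma ncyc_zero_left: "ncyc a b 0 m = ncyc a' b 0 m"
  by (simp add: ncyc_def exch_def)

section \<open>From diagonals to interval exchanges\<close>

text \<open>
  A point \<open>(s, i, c)\<close> is the cell in row \<open>i\<close> and column \<open>c\<close> of block \<open>s\<close>.
\<close>

definition block_right :: "('a \<Rightarrow> 'a) \<Rightarrow> nat \<Rightarrow> 'a \<times> nat \<times> nat \<Rightarrow> 'a \<times> nat \<times> nat" where
  "block_right a m = (\<lambda>(s, i, c). if c + 1 < m then (s, i, c + 1) else (a s, i, 0))"

definition block_down :: "('a \<Rightarrow> 'a) \<Rightarrow> nat \<Rightarrow> 'a \<times> nat \<times> nat \<Rightarrow> 'a \<times> nat \<times> nat" where
  "block_down b n = (\<lambda>(s, i, c). if i + 1 < n then (s, i + 1, c) else (b s, 0, c))"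

definition block_step ::
    "('a \<Rightarrow> 'a) \<Rightarrow> ('a \<Rightarrow> 'a) \<Rightarrow> nat \<Rightarrow> nat \<Rightarrow> 'a \<times> nat \<times> nat \<Rightarrow> 'a \<times> nat \<times> nat" where
  "block_step a b n m = block_down b n \<circ> block_right a m"

lemma block_step_closed:
  assumes "n > 0" "m > 0"
  shows "block_step a b n m ` (UNIV \<times> {..<n} \<times> {..<m}) \<subseteq> UNIV \<times> {..<n} \<times> {..<m}"
  using assms by (auto simp: block_step_def block_right_def block_down_def split: if_splits)

lemma block_step_funpow:
  "i + k < n \<Longrightarrow> c + k < m \<Longrightarrow> (block_step a b n m ^^ k) (s, i, c) = (s, i + k, c + k)"
  by (induction k) (auto simp: block_step_def block_right_def block_down_def)

lemma linked_block_step_along: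
  assumes "i + k < n" "c + k < m" "i' = i + k" "c' = c + k"
  shows "linked (block_step a b n m) (s, i, c) (s, i', c')"
  using linked_funpow[of "block_step a b n m" "(s, i, c)" k] assms
  by (simp add: block_step_funpow)

definition line_start :: "('a \<Rightarrow> 'a) \<Rightarrow> nat \<Rightarrow> nat \<Rightarrow> 'a \<times> nat \<Rightarrow> 'a \<times> nat \<times> nat" where
  "line_start b n m = (\<lambda>(s, x). if x = n + m - 1 then (b s, 0, 0)
     else if x \<ge> m - 1 then (s, x - (m - 1), 0) else (s, 0, m - 1 - x))"

text \<open>
  Within a block, \<open>i - c\<close> is constant along a diagonal; it is shifted by \<open>m - 1\<close> to make it
  nonnegative. The extra value \<open>n + m - 1\<close> stands for a diagonal that enters a block at its bottom
  left cell from the left and leaves it downwards at once, without a full step in between.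
\<close>

lemma norbits_block_step:
  assumes "n > 0" "m > 0"
  shows "norbits (block_step a b n m) (UNIV \<times> {..<n} \<times> {..<m}) = ncyc a b n m"
  unfolding ncyc_def
proof (rule norbits_eqI[where \<phi> = "\<lambda>(s, i, c). (s, i + (m - 1 - c))" and \<psi> = "line_start b n m"])
  show "block_step a b n m ` (UNIV \<times> {..<n} \<times> {..<m}) \<subseteq> UNIV \<times> {..<n} \<times> {..<m}"
    using assms by (rule block_step_closed)
  show "line_start b n m ` (UNIV \<times> {..<n + m}) \<subseteq> UNIV \<times> {..<n} \<times> {..<m}"
    using assms by (auto simp: line_start_def split: if_splits)
next
  fix p :: "'a \<times> nat \<times> nat" assume "p \<in> UNIV \<times> {..<n} \<times> {..<m}"
  then obtain s i c where p: "p = (s, i, c)" "i < n" "c < m" by auto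
  show "linked (exch a b n m) ((\<lambda>(s, i, c). (s, i + (m - 1 - c))) p)
          ((\<lambda>(s, i, c). (s, i + (m - 1 - c))) (block_step a b n m p))"
  proof -
    \<comment> \<open>Inside a block the line number does not change. Crossing one edge is one step
      of \<open>exch\<close>; crossing both at the bottom right corner is two steps, through the
      extra value \<open>n + m - 1\<close>.\<close>
    have "Suc c < m \<Longrightarrow> Suc (i + m - Suc (Suc c)) = i + m - Suc c"
      by arith
    then show ?thesis
      using p by (cases "c + 1 < m"; cases "i + 1 < n")
        (auto simp: block_step_def block_right_def block_down_def exch_apply linkedI_step(1,2))
  qed
  show "linked (block_step a b n m) (line_start b n m ((\<lambda>(s, i, c). (s, i + (m - 1 - c))) p)) p"
  proof (cases "i \<ge> c")
    case True
    then show ?thesis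
      using p by (auto simp: line_start_def intro!: linked_block_step_along[where k = c])
  next
    case False
    then show ?thesis
      using p by (auto simp: line_start_def intro!: linked_block_step_along[where k = i])
  qed
next
  fix y :: "'a \<times> nat" assume "y \<in> UNIV \<times> {..<n + m}"
  then obtain s x where y: "y = (s, x)" "x < n + m" by auto
  show "linked (exch a b n m) ((\<lambda>(s, i, c). (s, i + (m - 1 - c))) (line_start b n m y)) y"
    using y assms by (auto simp: line_start_def exch_apply linkedI_step(3))
  let ?f = "block_step a b n m"
  \<comment> \<open>The three ways to leave the block: through the right edge in row
    \<open>x\<close>, through the bottom edge in column \<open>n + m - 2 - x\<close>, or the extra
    value.\<close>
  consider "x < n" | "n \<le> x" "x < n + m - 1" | "x = n + m - 1"
    using y by linarith
  then show "linked ?f (line_start b n m y) (line_start b n m (exch a b n m y))"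
  proof cases
    case 1
    have ne: "x \<noteq> n + m - 1"
      using 1 assms by arith
    have "linked ?f (line_start b n m y) (s, x, m - 1)"
    proof (cases "x \<ge> m - 1")
      case True
      then have "line_start b n m y = (s, x - (m - 1), 0)"
        using ne y by (simp add: line_start_def)
      then show ?thesis
        using True 1 assms by (simp add: linked_block_step_along[where k = "m - 1"])
    next
      case False
      then have "line_start b n m y = (s, 0, m - 1 - x)"
        using ne y by (simp add: line_start_def)
      then show ?thesis
        using False 1 assms by (simp add: linked_block_step_along[where k = x])
    qed
    moreover have "?f (s, x, m - 1) = line_start b n m (exch a b n m y)"
      using 1 y assms
      by (auto simp: line_start_def exch_apply block_step_def block_right_def block_down_def)
    ultimately show ?thesis
      by (rule linked_trans[OF _ linkedI_step(1)])
  next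
    case 2
    have "linked ?f (line_start b n m y) (s, n - 1, n + m - 2 - x)"
    proof (cases "x \<ge> m - 1")
      case True
      then have "line_start b n m y = (s, x - (m - 1), 0)"
        using 2 y assms by (simp add: line_start_def)
      moreover have "x - (m - 1) + (n + m - 2 - x) = n - 1" "n + m - 2 - x < m"
        using True 2 assms by arith+
      ultimately show ?thesis
        using assms by (simp add: linked_block_step_along[where k = "n + m - 2 - x"])
    next
      case False
      then have "line_start b n m y = (s, 0, m - 1 - x)"
        using 2 y assms by (simp add: line_start_def)
      moreover have "m - 1 - x + (n - 1) = n + m - 2 - x" "n + m - 2 - x < m"
        using False 2 assms by arith+
      ultimately show ?thesis
        using assms by (simp add: linked_block_step_along[where k = "n - 1"])
    qed
    moreover have "?f (s, n - 1, n + m - 2 - x) = line_start b n m (exch a b n m y)"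
    proof -
      have "n + m - 2 - x + 1 < m" "n + m - 2 - x + 1 = m - 1 - (x - n)" "x - n < m - 1"
        "x - n \<noteq> n + m - 1"
        using 2 by arith+
      then show ?thesis
        using 2 y assms
        by (simp add: line_start_def exch_apply block_step_def block_right_def block_down_def)
    qed
    ultimately show ?thesis
      by (rule linked_trans[OF _ linkedI_step(1)])
  next
    case 3
    \<comment> \<open>Here \<open>exch\<close> gives \<open>(b s, m - 1)\<close>, whose line starts
      at \<open>(b s, 0, 0)\<close>, the very cell chosen by \<open>line_start\<close> for the extra
      value.\<close>
    then show ?thesis
      using y assms by (auto simp: line_start_def exch_def)
  qed
next
  show "exch a b n m ` (UNIV \<times> {..<n + m}) \<subseteq> UNIV \<times> {..<n + m}"
    by (rule exch_closed)
qed (use assms in auto)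

text \<open>
  The block \<open>(p, q)\<close> is in the lower half if \<open>p\<close> holds and in the right half if \<open>q\<close> holds.
\<close>

definition hop_right :: "bool \<times> bool \<Rightarrow> bool \<times> bool" where
  "hop_right = (\<lambda>(p, q). (p \<noteq> q, \<not> q))"

definition hop_down :: "bool \<times> bool \<Rightarrow> bool \<times> bool" where
  "hop_down = (\<lambda>(p, q). (\<not> p, p \<noteq> q))"

definition global_cell :: "nat \<Rightarrow> nat \<Rightarrow> (bool \<times> bool) \<times> nat \<times> nat \<Rightarrow> cell" where
  "global_cell n m = (\<lambda>((p, q), i, c). (if p then i + n else i, if q then c + m else c))"

definition local_cell :: "nat \<Rightarrow> nat \<Rightarrow> cell \<Rightarrow> (bool \<times> bool) \<times> nat \<times> nat" where
  "local_cell n m = (\<lambda>(i, c). ((n \<le> i, m \<le> c), if n \<le> i then i - n else i, if m \<le> c then c - m else c))"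

text \<open>Leaving the right half wraps around with a shift by \<open>n\<close> rows, which flips
  the row bit; this is the exclusive or in \<open>hop_right\<close>.\<close>

lemma right_global_cell:
  assumes "i < n" "c < m"
  shows "right n m (global_cell n m (s, i, c)) = global_cell n m (block_right hop_right m (s, i, c))"
  using assms
  by (cases s) (auto simp: right_def global_cell_def block_right_def hop_right_def add_half_mod_twice)

text \<open>Phrased as \<open>up\<close> undoing a move down, so that the inverse in
  \<open>diag_step\<close> can be read off from the injectivity of \<open>up\<close>.\<close>

lemma up_global_cell:
  assumes "i < n" "c < m"
  shows "up n m (global_cell n m (block_down hop_down n (s, i, c))) = global_cell n m (s, i, c)"
  using assms
  by (cases s) (auto simp: up_def global_cell_def block_down_def hop_down_def add_half_mod_twice)

lemma diag_step_global_cell: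
  assumes "i < n" "c < m"
  shows "diag_step n m (global_cell n m (s, i, c))
    = global_cell n m (block_step hop_right hop_down n m (s, i, c))"
proof -
  obtain s' c' where r: "block_right hop_right m (s, i, c) = (s', i, c')" "c' < m"
    using assms unfolding block_right_def by (cases "c + 1 < m") auto
  let ?d = "global_cell n m (block_down hop_down n (s', i, c'))"
  have "?d \<in> cells n m"
    using assms r by (auto simp: cells_def global_cell_def block_down_def split: prod.splits)
  moreover have "up n m ?d = global_cell n m (s', i, c')"
    using assms r up_global_cell by blast
  ultimately have "inv_into (cells n m) (up n m) (global_cell n m (s', i, c')) = ?d"
    using bij_betw_up by (metis bij_betw_inv_into_left)
  then show ?thesis
    using assms r by (simp add: diag_step_def right_global_cell block_step_def)
qed

text \<open>\<open>local_cell\<close> and \<open>global_cell\<close> conjugate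
  \<open>diag_step\<close> to \<open>block_step\<close>, whose orbits are counted by
  \<open>norbits_block_step\<close>.\<close>

theorem diag_eq_ncyc:
  assumes "n > 0" "m > 0"
  shows "diag n m = ncyc hop_right hop_down n m"
proof -
  let ?A = "(UNIV :: (bool \<times> bool) set) \<times> {..<n} \<times> {..<m}"
  let ?f = "block_step hop_right hop_down n m"
  have closed: "?f ` ?A \<subseteq> ?A"
    using assms by (rule block_step_closed)
  have global_local: "global_cell n m (local_cell n m z) = z" for z
    by (cases z) (auto simp: global_cell_def local_cell_def)
  have local_global: "local_cell n m (global_cell n m y) = y" if "y \<in> ?A" for y
    using that by (auto simp: global_cell_def local_cell_def split: if_splits)
  have local_in: "local_cell n m z \<in> ?A" if "z \<in> cells n m" for z
    using that by (auto simp: local_cell_def cells_def)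
  have step: "diag_step n m (global_cell n m y) = global_cell n m (?f y)" if "y \<in> ?A" for y
    using that diag_step_global_cell by auto
  have "diag n m = norbits (diag_step n m) (cells n m)"
    using card_forward_orbits[OF finite_cells bij_betw_diag_step]
    by (simp add: diag_def diagonal_def[abs_def])
  also have "\<dots> = norbits ?f ?A"
  proof (rule norbits_eqI[where \<phi> = "local_cell n m" and \<psi> = "global_cell n m"])
    show "diag_step n m ` cells n m \<subseteq> cells n m"
      using bij_betw_diag_step by (auto simp: bij_betw_def)
    show "global_cell n m ` ?A \<subseteq> cells n m"
      by (auto simp: global_cell_def cells_def)
    fix z assume "z \<in> cells n m"
    then have y: "local_cell n m z \<in> ?A"
      by (rule local_in)
    then have "?f (local_cell n m z) \<in> ?A"
      using closed by (auto simp only: image_subset_iff)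
    then have "local_cell n m (diag_step n m z) = ?f (local_cell n m z)"
      using step[OF y] by (simp only: global_local local_global)
    then show "linked ?f (local_cell n m z) (local_cell n m (diag_step n m z))"
      by (simp add: linked_step)
  next
    fix y assume "y \<in> ?A"
    then show "linked (diag_step n m) (global_cell n m y) (global_cell n m (?f y))"
      using step by (intro linkedI_step(1))
    show "linked ?f (local_cell n m (global_cell n m y)) y"
      using local_global[OF \<open>y \<in> ?A\<close>] by simp
  next
    show "?f ` ?A \<subseteq> ?A"
      by (rule closed)
    show "local_cell n m ` cells n m \<subseteq> ?A"
      using local_in by blast
  qed (simp add: global_local)
  finally show ?thesis
    by (simp only: norbits_block_step[OF assms])
qed

section \<open>Comparing the labels\<close>

text \<open>A check on four blocks. The periods 4, 3 and 2 govern the reductions of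
  \<open>q0\<close>, \<open>q1\<close> and \<open>q2\<close> respectively.\<close>

lemma hop_eqs:
  "hop_down ^^ 4 = id"
  "(hop_down \<circ> hop_right) ^^ 3 = id"
  "(hop_down \<circ> (hop_down \<circ> hop_right)) ^^ 2 = id"
  by (auto simp: fun_eq_iff hop_right_def hop_down_def numeral_eq_Suc)

lemma funpow_add_period: "f ^^ k = id \<Longrightarrow> f ^^ (k + j) = f ^^ j"
  by (simp add: funpow_add)

lemma funpow_mult_period: "f ^^ k = id \<Longrightarrow> f ^^ (k * j) = id"
  by (simp add: funpow_mult[symmetric])

section \<open>Reducing \<open>m\<close> modulo \<open>n\<close>: the cases
  \<open>q0 \<ge> 2\<close>\<close>

lemma diag_add_four_mult:
  assumes "n > 0" "m > 0"
  shows "diag n (m + (4 + j) * n) = diag n (m + j * n)"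
proof -
  have "diag n (m + i * n) = ncyc ((hop_down ^^ i) \<circ> hop_right) hop_down n m" for i
    using assms by (simp only: diag_eq_ncyc add_pos_nonneg ncyc_add_mult_right zero_le)
  then show ?thesis
    by (simp only: funpow_add_period[OF hop_eqs(1)])
qed

text \<open>Here \<open>k\<close> stands for \<open>n - r0\<close>. Both sides are brought to the
  lengths \<open>k\<close> and \<open>r\<close>.\<close>

lemma diag_add_three_mult:
  assumes "k > 0" "r > 0"
  shows "diag (k + r) (r + 3 * (k + r)) = diag (k + r) k"
proof -
  have "diag (k + r) (r + 3 * (k + r)) = ncyc ((hop_down ^^ 3) \<circ> hop_right) hop_down (k + r) r"
    using assms by (simp only: diag_eq_ncyc add_pos_nonneg ncyc_add_mult_right zero_le)
  also have "\<dots> = ncyc ((hop_down ^^ 3) \<circ> hop_right) (hop_down \<circ> ((hop_down ^^ 3) \<circ> hop_right)) k r"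
    by (rule ncyc_add_left)
  \<comment> \<open>Negating the row bit commutes with \<open>hop_right\<close> and inverts
    \<open>hop_down\<close>. Hence \<open>hop_down ^^ 3\<close>, the inverse of
    \<open>hop_down\<close>, turns into \<open>hop_down\<close>, and the second label is just
    \<open>hop_right\<close>.\<close>
  also have "\<dots> = ncyc (hop_down \<circ> hop_right) hop_right k r"
    by (rule ncyc_conj[where h = "\<lambda>(p, q). (\<not> p, q)" and h' = "\<lambda>(p, q). (\<not> p, q)"])
      (auto simp: fun_eq_iff hop_right_def hop_down_def numeral_eq_Suc)
  also have "\<dots> = ncyc hop_right (hop_down \<circ> hop_right) r k"
    by (rule ncyc_swap)
  also have "\<dots> = ncyc hop_right hop_down (r + k) k"
    by (rule ncyc_add_left[symmetric])
  finally show ?thesis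
    using assms by (simp only: diag_eq_ncyc add_pos_nonneg zero_le add.commute[of r k])
qed

lemma diag_add_two_mult:
  assumes "k > 0" "r > 0"
  shows "diag (k + r) (r + 2 * (k + r)) = diag (k + r) (k + (k + r))"
proof -
  have "diag (k + r) (r + 2 * (k + r)) = ncyc ((hop_down ^^ 2) \<circ> hop_right) hop_down (k + r) r"
    using assms by (simp only: diag_eq_ncyc add_pos_nonneg ncyc_add_mult_right zero_le)
  also have "\<dots> = ncyc ((hop_down ^^ 2) \<circ> hop_right) (hop_down \<circ> ((hop_down ^^ 2) \<circ> hop_right)) k r"
    by (rule ncyc_add_left)
  \<comment> \<open>Under the same conjugation \<open>hop_down ^^ 2\<close> is fixed, being its own
    inverse, and \<open>hop_down ^^ 3\<close> becomes \<open>hop_down\<close>.\<close>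
  also have "\<dots> = ncyc (hop_down \<circ> (hop_down \<circ> hop_right)) (hop_down \<circ> hop_right) k r"
    by (rule ncyc_conj[where h = "\<lambda>(p, q). (\<not> p, q)" and h' = "\<lambda>(p, q). (\<not> p, q)"])
      (auto simp: fun_eq_iff hop_right_def hop_down_def numeral_eq_Suc)
  also have "\<dots> = ncyc (hop_down \<circ> hop_right) (hop_down \<circ> (hop_down \<circ> hop_right)) r k"
    by (rule ncyc_swap)
  also have "\<dots> = ncyc (hop_down \<circ> hop_right) hop_down (r + k) k"
    by (rule ncyc_add_left[symmetric])
  also have "\<dots> = ncyc hop_right hop_down (r + k) (k + (r + k))"
    by (rule ncyc_add_right[symmetric])
  finally show ?thesis
    using assms by (simp only: diag_eq_ncyc add_pos_nonneg zero_le add.commute[of r k])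
qed

section \<open>Two division steps: \<open>q0 = 1\<close> and \<open>q1 \<ge> 2\<close>\<close>

text \<open>The pair with \<open>q0 = 1\<close>, \<open>q1 = j\<close>, \<open>r0 = r\<close> and
  \<open>r1 = s\<close>: first \<open>n\<close> is removed from \<open>m\<close>, then
  \<open>j\<close> copies of \<open>r\<close> from \<open>n\<close>. The value \<open>s = 0\<close>
  is allowed if \<open>j > 0\<close>.\<close>

lemma diag_eq_ncyc_mult:
  assumes "r > 0" "s + j * r > 0"
  shows "diag (s + j * r) (r + (s + j * r))
    = ncyc (hop_down \<circ> hop_right) (hop_down \<circ> (hop_down \<circ> hop_right) ^^ j) s r"
  using assms
  by (simp only: diag_eq_ncyc add_pos_nonneg zero_le ncyc_add_right ncyc_add_mult_left)

lemma diag_drop_three: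
  assumes "r > 0" "s + j * r > 0"
  shows "diag (s + (3 + j) * r) (r + (s + (3 + j) * r)) = diag (s + j * r) (r + (s + j * r))"
proof -
  have "s + (3 + j) * r > 0"
    using assms by simp
  then show ?thesis
    using assms by (simp only: diag_eq_ncyc_mult funpow_add_period[OF hop_eqs(2)])
qed

text \<open>Here \<open>s\<close> is \<open>r1\<close> and \<open>k\<close> is
  \<open>r0 - r1\<close>.\<close>

lemma diag_drop_two:
  assumes "k > 0" "s > 0"
  shows "diag (s + 2 * (k + s)) ((k + s) + (s + 2 * (k + s))) = diag s k"
proof -
  let ?a = "hop_down \<circ> hop_right"
  have "diag (s + 2 * (k + s)) ((k + s) + (s + 2 * (k + s))) = ncyc ?a (hop_down \<circ> ?a ^^ 2) s (k + s)"
    using assms by (intro diag_eq_ncyc_mult) simp_all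
  also have "\<dots> = ncyc (hop_down \<circ> ?a ^^ 2 \<circ> ?a) (hop_down \<circ> ?a ^^ 2) s k"
    by (rule ncyc_add_right)
  \<comment> \<open>Since \<open>(hop_down \<circ> hop_right) ^^ 3 = id\<close>, the first label
    equals \<open>hop_down\<close>; the permutation \<open>h\<close> turns it into
    \<open>hop_right\<close> and the second label into \<open>hop_down\<close>.\<close>
  also have "\<dots> = ncyc hop_right hop_down s k"
    by (rule ncyc_conj[where h = "\<lambda>(p, q). (p \<noteq> q, \<not> p)" and h' = "\<lambda>(p, q). (\<not> q, p = q)"])
      (auto simp: fun_eq_iff hop_right_def hop_down_def numeral_eq_Suc)
  finally show ?thesis
    using assms by (simp only: diag_eq_ncyc)
qed

section \<open>Three division steps: \<open>q0 = q1 = 1\<close>\<close>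

text \<open>With \<open>s\<close>, \<open>t\<close>, \<open>q\<close> for \<open>r1\<close>,
  \<open>r2\<close>, \<open>q2\<close>, so that \<open>r0 = t + q * s\<close>, three Euclidean
  reductions lead to the lengths \<open>s\<close> and \<open>t\<close>. Only the parity of
  \<open>q\<close> matters, as the iterated label is an involution.\<close>

lemma diag_near_one_half:
  assumes "s > 0" "t + q * s > 0"
  shows "diag (s + (t + q * s)) ((t + q * s) + (s + (t + q * s)))
    = ncyc ((hop_down \<circ> (hop_down \<circ> hop_right)) ^^ q \<circ> (hop_down \<circ> hop_right))
        (hop_down \<circ> (hop_down \<circ> hop_right)) s t"
  using assms
  by (simp only: diag_eq_ncyc add_pos_nonneg zero_le ncyc_add_right ncyc_add_left ncyc_add_mult_right)

text \<open>An even power of the involution vanishes, and the right-hand side is the same reduction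
  with \<open>q = 0\<close>. The case \<open>t = 0\<close> is included.\<close>

lemma diag_near_one_half_even:
  assumes "s > 0" "t + q * s > 0" "even q"
  shows "diag (s + (t + q * s)) ((t + q * s) + (s + (t + q * s))) = diag (s + t) (t + (s + t))"
proof -
  obtain j where "q = 2 * j"
    using assms(3) by (rule evenE)
  moreover have "ncyc (hop_down \<circ> hop_right) (hop_down \<circ> (hop_down \<circ> hop_right)) s t
      = diag (s + t) (t + (s + t))"
    using assms by (simp only: diag_eq_ncyc add_pos_nonneg zero_le ncyc_add_right ncyc_add_left)
  ultimately show ?thesis
    using diag_near_one_half[OF assms(1,2)] by (simp only: funpow_mult_period[OF hop_eqs(3)] id_comp)
qed

lemma diag_near_one_half_odd:
  assumes "s > 0" "t + q * s > 0" "odd q"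
  shows "diag (s + (t + q * s)) ((t + q * s) + (s + (t + q * s)))
    = ncyc (hop_down \<circ> (hop_down \<circ> hop_right) \<circ> (hop_down \<circ> hop_right))
        (hop_down \<circ> (hop_down \<circ> hop_right)) s t"
proof -
  let ?f = "hop_down \<circ> (hop_down \<circ> hop_right)"
  obtain j where q: "q = 2 * j + 1"
    using assms(3) by (rule oddE)
  have "?f ^^ q = ?f ^^ (2 * j) \<circ> ?f ^^ 1"
    unfolding q by (rule funpow_add)
  also have "\<dots> = ?f"
    by (simp only: funpow_mult_period[OF hop_eqs(3)] id_comp funpow_simps_right One_nat_def funpow_0 comp_id)
  finally show ?thesis
    using diag_near_one_half[OF assms(1,2)] by (simp only:)
qed

lemma diag_near_one_half_odd_pos:
  assumes "s > 0" "t > 0" "odd q"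
  shows "diag (s + (t + q * s)) ((t + q * s) + (s + (t + q * s))) = diag t (s + 2 * t)"
proof -
  have "diag (s + (t + q * s)) ((t + q * s) + (s + (t + q * s)))
      = ncyc (hop_down \<circ> (hop_down \<circ> hop_right) \<circ> (hop_down \<circ> hop_right))
        (hop_down \<circ> (hop_down \<circ> hop_right)) s t"
    using assms by (intro diag_near_one_half_odd) simp_all
  \<comment> \<open>\<open>h\<close> is its own inverse. It makes the labels those of a pair from
    which \<open>2 * t\<close> has been removed, after swapping the intervals.\<close>
  also have "\<dots> = ncyc hop_down (hop_down ^^ 2 \<circ> hop_right) s t"
    by (rule ncyc_conj[where h = "\<lambda>(p, q). (p = q, q)" and h' = "\<lambda>(p, q). (p = q, q)"])
      (auto simp: fun_eq_iff hop_right_def hop_down_def numeral_eq_Suc)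
  also have "\<dots> = ncyc (hop_down ^^ 2 \<circ> hop_right) hop_down t s"
    by (rule ncyc_swap)
  also have "\<dots> = ncyc hop_right hop_down t (s + 2 * t)"
    by (rule ncyc_add_mult_right[symmetric])
  finally show ?thesis
    using assms by (simp only: diag_eq_ncyc add_pos_nonneg zero_le)
qed

text \<open>For \<open>s = 1\<close> and \<open>t = 0\<close> one interval is empty, so only one
  label counts. It agrees with the label left over when the pair 2, 3 is reduced.\<close>

lemma diag_near_one_half_odd_zero:
  assumes "odd q"
  shows "diag (1 + q) (q + (1 + q)) = diag 2 3"
proof -
  let ?a = "hop_down \<circ> hop_right"
  have "diag (1 + q) (q + (1 + q)) = ncyc (hop_down \<circ> ?a \<circ> ?a) (hop_down \<circ> ?a) 1 0"
    using diag_near_one_half_odd[of 1 0 q] assms odd_pos[OF assms] by simp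
  also have "\<dots> = ncyc (hop_down \<circ> ?a) (hop_down \<circ> ?a ^^ 2) 0 1"
    by (subst ncyc_swap) (simp add: numeral_2_eq_2 comp_assoc)
  also have "\<dots> = ncyc ?a (hop_down \<circ> ?a ^^ 2) 0 1"
    by (rule ncyc_zero_left)
  also have "\<dots> = diag (0 + 2 * 1) (1 + (0 + 2 * 1))"
    by (rule diag_eq_ncyc_mult[symmetric]) simp_all
  finally show ?thesis
    by (simp add: numeral_eq_Suc)
qed


theorem proposition9:
  fixes n m q0 r0 q1 r1 q2 r2 :: nat
  assumes "n \<ge> 2" and "m \<ge> 1" and "coprime n m"
    and "m = q0 * n + r0" and "0 < r0" and "r0 < n"
    and "n = q1 * r0 + r1" and "r1 < r0"
    and "r1 > 0 \<Longrightarrow> r0 = q2 * r1 + r2 \<and> r2 < r1"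
  shows "(q0 \<ge> 4 \<longrightarrow> diag n m = diag n ((q0 - 4) * n + r0))
    \<and> (q0 = 3 \<longrightarrow> diag n m = diag n (n - r0))
    \<and> (q0 = 2 \<longrightarrow> diag n m = diag n (2 * n - r0))
    \<and> (q0 = 1 \<and> q1 \<ge> 4 \<longrightarrow>
         diag n m = diag ((q1 - 3) * r0 + r1) ((q1 - 2) * r0 + r1))
    \<and> (q0 = 1 \<and> q1 = 3 \<and> r1 > 0 \<longrightarrow> diag n m = diag r1 (r0 + r1))
    \<and> (q0 = 1 \<and> q1 = 2 \<and> r1 > 0 \<longrightarrow> diag n m = diag r1 (r0 - r1))
    \<and> (q0 = 1 \<and> q1 = 1 \<and> even q2 \<and> r1 > r2 \<and> r2 > 0 \<longrightarrow>
         diag n m = diag (r1 + r2) (r1 + 2 * r2))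
    \<and> (q0 = 1 \<and> q1 = 1 \<and> even q2 \<and> r1 > r2 \<and> r2 = 0 \<longrightarrow> diag n m = diag 1 1)
    \<and> (q0 = 1 \<and> q1 = 1 \<and> odd q2 \<and> r1 > r2 \<and> r2 > 0 \<longrightarrow>
         diag n m = diag r2 (r1 + 2 * r2))
    \<and> (q0 = 1 \<and> q1 = 1 \<and> odd q2 \<and> r1 > r2 \<and> r2 = 0 \<longrightarrow> diag n m = diag 2 3)"
proof -
  \<comment> \<open>Covers \<open>q1 \<ge> 4\<close> and \<open>q1 = 3\<close> together; the last
    condition makes the reduced row parameter \<open>(q1 - 3) * r0 + r1\<close> positive.\<close>
  have three: "diag n m = diag ((q1 - 3) * r0 + r1) ((q1 - 2) * r0 + r1)"
    if asm: "q0 = 1" "q1 \<ge> 3" "q1 \<ge> 4 \<or> r1 > 0"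
  proof -
    obtain j where j: "q1 = 3 + j"
      using asm(2) le_Suc_ex by blast
    have "n = r1 + (3 + j) * r0" "m = r0 + (r1 + (3 + j) * r0)"
      "(q1 - 3) * r0 + r1 = r1 + j * r0" "(q1 - 2) * r0 + r1 = r0 + (r1 + j * r0)"
      using assms(4,7) that(1) by (simp_all add: j algebra_simps)
    moreover have "r1 + j * r0 > 0"
      using that(3) assms(5) by (auto simp: j)
    ultimately show ?thesis
      using diag_drop_three[of r0 r1 j] assms(5) by (simp only:)
  qed
  \<comment> \<open>From \<open>r1 > r2\<close> follows \<open>r1 > 0\<close>, so the third division
    is available.\<close>
  have half: "n = r1 + (r2 + q2 * r1)" "m = (r2 + q2 * r1) + (r1 + (r2 + q2 * r1))"
    "r2 + q2 * r1 > 0" if "q0 = 1" "q1 = 1" "r1 > r2"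
    using assms(4,5,7,9) that by auto
  \<comment> \<open>With \<open>r2 = 0\<close> the Euclidean algorithm ends at \<open>r1\<close>, a
    common divisor of \<open>n\<close> and \<open>m\<close>.\<close>
  have r1_1: "r1 = 1" if "q0 = 1" "q1 = 1" "r1 > r2" "r2 = 0"
  proof -
    have "r1 dvd n" "r1 dvd m"
      using half[OF that(1-3)] that(4) by simp_all
    then show ?thesis
      using assms(3) coprime_common_divisor_nat by blast
  qed
  show ?thesis
  proof (intro conjI impI; (elim conjE)?)
    assume "q0 \<ge> 4"
    then obtain j where "q0 = 4 + j"
      using le_Suc_ex by blast
    then have "m = r0 + (4 + j) * n" "(q0 - 4) * n + r0 = r0 + j * n"
      using assms(4) by simp_all
    then show "diag n m = diag n ((q0 - 4) * n + r0)"
      using diag_add_four_mult[of n r0 j] assms(1,5) by (simp only:)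
  next
    assume "q0 = 3"
    then have "n = (n - r0) + r0" "m = r0 + 3 * ((n - r0) + r0)"
      using assms(4,6) by simp_all
    then show "diag n m = diag n (n - r0)"
      using diag_add_three_mult[of "n - r0" r0] assms(5,6) by simp
  next
    assume "q0 = 2"
    then have "n = (n - r0) + r0" "m = r0 + 2 * ((n - r0) + r0)" "2 * n - r0 = n - r0 + n"
      using assms(4,6) by simp_all
    then show "diag n m = diag n (2 * n - r0)"
      using diag_add_two_mult[of "n - r0" r0] assms(5,6) by simp
  next
    assume "q0 = 1" "q1 \<ge> 4"
    then show "diag n m = diag ((q1 - 3) * r0 + r1) ((q1 - 2) * r0 + r1)"
      using three by simp
  next
    assume "q0 = 1" "q1 = 3" "r1 > 0"
    then show "diag n m = diag r1 (r0 + r1)"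
      using three by simp
  next
    assume *: "q0 = 1" "q1 = 2" "r1 > 0"
    have "r0 = (r0 - r1) + r1"
      using assms(8) by simp
    then have "n = r1 + 2 * ((r0 - r1) + r1)" "m = ((r0 - r1) + r1) + (r1 + 2 * ((r0 - r1) + r1))"
      using * assms(4,7) by simp_all
    then show "diag n m = diag r1 (r0 - r1)"
      using diag_drop_two[of "r0 - r1" r1] * assms(8) by (simp only: zero_less_diff)
  next
    assume *: "q0 = 1" "q1 = 1" "even q2" "r1 > r2" "r2 > 0"
    have "r1 + 2 * r2 = r2 + (r1 + r2)"
      by simp
    then show "diag n m = diag (r1 + r2) (r1 + 2 * r2)"
      using diag_near_one_half_even[OF less_trans[OF *(5,4)] half(3)[OF *(1,2,4)] *(3)]
      by (simp only: half(1,2)[OF *(1,2,4)])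
  next
    assume *: "q0 = 1" "q1 = 1" "even q2" "r1 > r2" "r2 = 0"
    then have "r1 = 1"
      by (intro r1_1)
    then show "diag n m = diag 1 1"
      using diag_near_one_half_even[of r1 r2 q2] half * by simp
  next
    assume *: "q0 = 1" "q1 = 1" "odd q2" "r1 > r2" "r2 > 0"
    show "diag n m = diag r2 (r1 + 2 * r2)"
      using diag_near_one_half_odd_pos[OF less_trans[OF *(5,4)] *(5,3)]
      by (simp only: half(1,2)[OF *(1,2,4)])
  next
    assume *: "q0 = 1" "q1 = 1" "odd q2" "r1 > r2" "r2 = 0"
    then have "r1 = 1"
      by (intro r1_1)
    then show "diag n m = diag 2 3"
      using diag_near_one_half_odd_zero[of q2] half * by simp
  qed
qed

end
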